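(* Let $k\geq 1$ be an integer. For each $n\ge 1$ let $X_n$ be a set of $n$ independent uniform random points in the unit square $[0,1]^2$, let $L^k_n$ be the maximal length of a chain $(p_1,\dots,p_m)$ of points of $X_n$ such that $(\gamma_k(0)^{\circ k},p_1,\dots,p_m,\gamma_k(1)^{\circ k})$ is a $k$-monotone chain, and let $\alpha_k=\lim_{n\to\infty} n^{-1/(k+1)}\,\mathbb{E}L^k_n$ (this limit exists and is a positive constant). Then for every $\varepsilon>0$, $$\mathbb{P}\left(|L^k_n-\mathbb{E}L^k_n|>\varepsilon\, n^{\frac1{2(k+1)}}\right)\leq 5\,e^{-\varepsilon^2/(5\alpha_k)}$$ holds for every sufficiently large $n$.
   Context: Notation: $\gamma_k(x)=(x,x^k)$ for $x\ge 0$, and $p^{\circ i}$ denotes the point $p$ repeated $i$ times. A chain is a sequence of points whose $x$-coordinates are increasing (repeated copies of the same point are allowed only where explicitly indicated, and are listed consecutively). The length of a chain $(p_1,\dots,p_m)$ is $m$; the empty chain has length $0$. Divided differences: for points $p_i=(x_i,y_i)$, $\Delta_0(p_i)=y_i$ and $$\Delta_j(p_i,\dots,p_{i+j})=\frac{\Delta_{j-1}(p_{i+1},\dots,p_{i+j})-\Delta_{j-1}(p_i,\dots,p_{i+j-1})}{x_{i+j}-x_i}.$$ For multisets, all repeated points are required to lie on the graph of the function $f(x)=x^k$; one sets $\Delta_i(p^{\circ(i+1)})=f^{(i)}(x)/i!$ for $p=(x,f(x))$, and otherwise uses the recursion for $\Delta_j$ with the points listed in nondecreasing order of $x$-coordinates.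 A $(k+1)$-tuple is positive if its $k$-th divided difference $\Delta_k$ is nonnegative (for distinct points this is equivalent to the tuple lying on the graph of a function whose $k$-th derivative exists everywhere and is nowhere negative). A chain (possibly with repeated points, all of which lie on the graph of $f(x)=x^k$) is $k$-monotone if every $(k+1)$-tuple of its members, counted with multiplicity, is positive. With probability 1 the points of $X_n$ have distinct $x$-coordinates and no $k+1$ of them lie on the graph of a polynomial of degree at most $k-1$; this is assumed throughout. *)

theory Defs
  imports "HOL-Probability.Probability" "HOL-Library.Sublist"
begin

definition \<gamma> :: "nat \<Rightarrow> real \<Rightarrow> real \<times> real" where
  "\<gamma> k x = (x, x ^ k)"

text \<open>
  \<open>divdiff k ps\<close> is the divided difference of order \<open>length ps - 1\<close> of the tuple \<open>ps\<close>, which has to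
  be listed in nondecreasing order of x-coordinates. The parameter \<open>k\<close> enters only through the
  curve \<open>y = x ^ k\<close>, which supplies the values at fully repeated points. The function is only
  meaningful on tuples in which distinct points have distinct x-coordinates (then the denominator is
  nonzero) and repeated points lie on that curve; \<open>k_monotone\<close> below imposes both.
\<close>

fun divdiff :: "nat \<Rightarrow> (real \<times> real) list \<Rightarrow> real" where
  "divdiff k [] = 0"
| "divdiff k [p] = snd p"
| "divdiff k (p # q # ps) =
     (if set (q # ps) = {p}
      then (deriv ^^ length (q # ps)) (\<lambda>x. x ^ k) (fst p) / fact (length (q # ps))
      else (divdiff k (q # ps) - divdiff k (butlast (p # q # ps))) /
           (fst (last (q # ps)) - fst p))"

definition positive_tuple :: "nat \<Rightarrow> (real \<times> real) list \<Rightarrow> bool" where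
  "positive_tuple k ps \<longleftrightarrow> length ps = k + 1 \<and> 0 \<le> divdiff k ps"

text \<open>
  Chains with repetitions are lists, so sublists (\<open>subseq\<close>) of length \<open>k + 1\<close> are exactly the
  \<open>(k + 1)\<close>-tuples of members counted with multiplicity, in nondecreasing order of x-coordinates.
\<close>

definition k_monotone :: "nat \<Rightarrow> (real \<times> real) list \<Rightarrow> bool" where
  "k_monotone k ps \<longleftrightarrow>
     sorted_wrt (\<lambda>p q. fst p < fst q \<or> p = q) ps \<and>
     (\<forall>p\<in>set ps. 1 < count_list ps p \<longrightarrow> p = \<gamma> k (fst p)) \<and>
     (\<forall>qs. subseq qs ps \<and> length qs = k + 1 \<longrightarrow> positive_tuple k qs)"

text \<open>
  The first conjunct says that only the two endpoints are repeated in the extended chain, and only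
  \<open>k\<close> times each.
\<close>

definition admissible_chain :: "nat \<Rightarrow> (real \<times> real) list \<Rightarrow> bool" where
  "admissible_chain k ps \<longleftrightarrow>
     sorted_wrt (\<lambda>p q. fst p < fst q) (\<gamma> k 0 # ps @ [\<gamma> k 1]) \<and>
     k_monotone k (replicate k (\<gamma> k 0) @ ps @ replicate k (\<gamma> k 1))"

definition max_chain_length :: "nat \<Rightarrow> (real \<times> real) set \<Rightarrow> nat" where
  "max_chain_length k S = Max {length ps |ps. set ps \<subseteq> S \<and> admissible_chain k ps}"

text \<open>\<open>Y 0, \<dots>, Y (n - 1)\<close> are the random points forming the random set \<open>X\<^sub>n\<close>.\<close>

definition L :: "nat \<Rightarrow> nat \<Rightarrow> (nat \<Rightarrow> 'a \<Rightarrow> real \<times> real) \<Rightarrow> 'a \<Rightarrow> nat" where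
  "L k n Y \<omega> = max_chain_length k ((\<lambda>i. Y i \<omega>) ` {..<n})"

end

theory Submission
  imports Defs
begin

text \<open>
  Subchains of admissible chains are admissible, so \<open>L\<close> is a configuration function: the largest
  size of a set in a hereditary family of index sets. Deleting one point lowers \<open>L\<close> by \<open>0\<close> or \<open>1\<close>, and
  it lowers it by \<open>1\<close> only for points of a fixed longest chain, so the decrements add up to at most \<open>L\<close>.
  By subadditivity of entropy the logarithm \<open>\<psi>\<close> of the moment generating function of \<open>L\<close> satisfies
  \<open>(1 - exp (- l)) \<psi>' \<le> \<psi>\<close>, whence \<open>\<psi> l \<le> (exp l - 1) E L\<close> for all real \<open>l\<close> (Boucheron, Lugosi and
  Massart). Chernoff's bound turns this into \<open>P(\<bar>L - E L\<bar> \<ge> t) \<le> 2 exp (- t\<^sup>2 / (4 E L))\<close> for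
  \<open>t \<le> 2 E L\<close>, and \<open>E L\<close> is asymptotic to \<open>\<alpha> n powr (1 / (k + 1))\<close>.
\<close>

subsection \<open>Entropy of functions on product spaces\<close>

lemma integrable_bounded:
  fixes f :: "'a \<Rightarrow> real"
  assumes "prob_space M" "f \<in> borel_measurable M" "\<And>x. x \<in> space M \<Longrightarrow> \<bar>f x\<bar> \<le> B"
  shows "integrable M f"
proof -
  interpret prob_space M by fact
  show ?thesis
    by (rule integrable_const_bound[of _ B]) (use assms in auto)
qed

lemma abs_integral_le_bound:
  fixes f :: "'a \<Rightarrow> real"
  assumes "prob_space M" "f \<in> borel_measurable M" "\<And>x. x \<in> space M \<Longrightarrow> \<bar>f x\<bar> \<le> B"
  shows "\<bar>\<integral>x. f x \<partial>M\<bar> \<le> B"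
proof -
  interpret prob_space M by fact
  have int: "integrable M f" by (rule integrable_bounded) fact+
  have "(\<integral>x. f x \<partial>M) \<le> (\<integral>x. B \<partial>M)" "(\<integral>x. - B \<partial>M) \<le> (\<integral>x. f x \<partial>M)"
    by (rule integral_mono; use int assms(3) in \<open>fastforce simp: abs_le_iff\<close>)+
  then show ?thesis by (simp add: prob_space)
qed

section \<open>Splitting off one coordinate of a product measure\<close>

lemma measurable_fun_upd_PiM:
  assumes "i \<notin> I" "f \<in> measurable (PiM (insert i I) M) N"
  shows "(\<lambda>(x, y). f (x(i := y))) \<in> measurable (PiM I M \<Otimes>\<^sub>M M i) N"
    and "y \<in> space (M i) \<Longrightarrow> (\<lambda>x. f (x(i := y))) \<in> measurable (PiM I M) N"
proof -
  have u: "(\<lambda>(x, y). x(i := y)) \<in> measurable (PiM I M \<Otimes>\<^sub>M M i) (PiM (insert i I) M)"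
    by (rule measurable_add_dim)
  show 1: "(\<lambda>(x, y). f (x(i := y))) \<in> measurable (PiM I M \<Otimes>\<^sub>M M i) N"
    using measurable_compose[OF u assms(2)] by (simp add: case_prod_unfold)
  show "(\<lambda>x. f (x(i := y))) \<in> measurable (PiM I M) N" if "y \<in> space (M i)" for y
    using measurable_compose[OF measurable_Pair2'[OF that] 1] by simp
qed

lemma fun_upd_in_space_PiM:
  "x \<in> space (PiM I M) \<Longrightarrow> y \<in> space (M i) \<Longrightarrow> x(i := y) \<in> space (PiM (insert i I) M)"
  by (auto simp: space_PiM PiE_iff extensional_def)

lemma measurable_integral_fun_upd:
  fixes f :: "('i \<Rightarrow> 'a) \<Rightarrow> real"
  assumes "\<And>i. prob_space (M i)" "finite I" "i \<notin> I" "f \<in> borel_measurable (PiM (insert i I) M)"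
  shows "(\<lambda>y. \<integral>x. f (x(i := y)) \<partial>PiM I M) \<in> borel_measurable (M i)"
proof -
  interpret I: prob_space "PiM I M" by (rule prob_space_PiM) (rule assms)
  have "(\<lambda>(y, x). f (x(i := y))) \<in> borel_measurable (M i \<Otimes>\<^sub>M PiM I M)"
    using measurable_pair_swap[OF measurable_fun_upd_PiM(1)[OF assms(3,4)]]
    by (simp add: case_prod_unfold)
  then show ?thesis by (rule I.borel_measurable_lebesgue_integral)
qed

text \<open>Fubini's theorem for bounded functions puts the new coordinate \<open>i\<close>
  outermost. The induction on the index set needs this order, because its hypothesis is applied to
  sections with that coordinate frozen.\<close>

lemma integral_PiM_insert_rev:
  fixes f :: "('i \<Rightarrow> 'a) \<Rightarrow> real"
  assumes M: "\<And>i. prob_space (M i)" and I: "finite I" "i \<notin> I"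
    and f: "f \<in> borel_measurable (PiM (insert i I) M)"
    and B: "\<And>x. x \<in> space (PiM (insert i I) M) \<Longrightarrow> \<bar>f x\<bar> \<le> B"
  shows "(\<integral>x. f x \<partial>PiM (insert i I) M) = (\<integral>y. \<integral>x. f (x(i := y)) \<partial>PiM I M \<partial>M i)"
proof -
  interpret product_sigma_finite M
    using M by (simp add: product_sigma_finite_def prob_space_imp_sigma_finite)
  interpret i: prob_space "M i" by (rule M)
  interpret I: prob_space "PiM I M" by (rule prob_space_PiM) (rule M)
  interpret P: pair_prob_space "PiM I M" "M i" ..
  have "integrable (PiM (insert i I) M) f"
    by (rule integrable_bounded[OF prob_space_PiM f B]) (rule M)
  then have "(\<integral>x. f x \<partial>PiM (insert i I) M) = (\<integral>x. \<integral>y. f (x(i := y)) \<partial>M i \<partial>PiM I M)"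
    by (rule product_integral_insert[OF I])
  also have "\<dots> = (\<integral>y. \<integral>x. f (x(i := y)) \<partial>PiM I M \<partial>M i)"
    by (rule P.Fubini_integral[symmetric], rule integrable_bounded[OF P.prob_space_axioms, of _ B])
      (use measurable_fun_upd_PiM(1)[OF I(2) f] B in
        \<open>auto simp: space_pair_measure intro: fun_upd_in_space_PiM\<close>)
  finally show ?thesis .
qed

text \<open>This is \<open>ln x \<le> x - 1\<close> at \<open>x = b / exp a\<close>, multiplied by
  \<open>exp a\<close>; equivalently \<open>u ln (u / b) - u + b \<ge> 0\<close> for
  \<open>u = exp a\<close>.\<close>

lemma gibbs_pointwise:
  fixes a b :: real
  assumes "0 < b"
  shows "exp a - b \<le> exp a * (a - ln b)"
proof -
  have "ln (b / exp a) \<le> b / exp a - 1"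
    by (rule ln_le_minus_one) (use assms in simp)
  then have "ln b - a \<le> b / exp a - 1"
    using assms by (simp add: ln_div)
  then have "exp a * (ln b - a) \<le> exp a * (b / exp a - 1)"
    by (rule mult_left_mono) simp
  then show ?thesis by (simp add: algebra_simps)
qed

text \<open>
  Subadditivity of entropy, where the entropy in the coordinate \<open>i\<close> has already been bounded through
  its variational formula \<open>Ent f = inf\<^bsub>u > 0\<^esub> E[f ln (f / u) - f + u]\<close>, used with \<open>f = exp h\<close> and
  \<open>u = exp (g i)\<close>. Integrating out the coordinate \<open>i\<close> last, it is Gibbs' inequality against the
  marginal of \<open>exp h\<close>.
\<close>

theorem entropy_tensorization:
  fixes h :: "('i \<Rightarrow> 'a) \<Rightarrow> real" and g :: "'i \<Rightarrow> ('i \<Rightarrow> 'a) \<Rightarrow> real"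
  assumes M: "\<And>i. prob_space (M i)" and "finite I"
    and "h \<in> borel_measurable (PiM I M)"
    and "\<And>i. i \<in> I \<Longrightarrow> g i \<in> borel_measurable (PiM I M)"
    and "\<And>x. x \<in> space (PiM I M) \<Longrightarrow> \<bar>h x\<bar> \<le> B"
    and "\<And>i x. i \<in> I \<Longrightarrow> x \<in> space (PiM I M) \<Longrightarrow> \<bar>g i x\<bar> \<le> B"
    and "\<And>i x y. i \<in> I \<Longrightarrow> x \<in> space (PiM I M) \<Longrightarrow> y \<in> space (M i) \<Longrightarrow> g i (x(i := y)) = g i x"
  shows "(\<integral>x. exp (h x) * h x \<partial>PiM I M) - (\<integral>x. exp (h x) \<partial>PiM I M) * ln (\<integral>x. exp (h x) \<partial>PiM I M)
    \<le> (\<Sum>i\<in>I. \<integral>x. exp (h x) * (h x - g i x - 1) + exp (g i x) \<partial>PiM I M)"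
  using assms(2-)
proof (induction I arbitrary: h g rule: finite_induct)
  case empty
  interpret prob_space "PiM {} M" by (rule prob_space_PiM) (rule M)
  \<comment> \<open>The empty product is a point mass, where the entropy on the left is
    zero.\<close>
  have "(\<integral>x. f x \<partial>PiM {} M) = f (\<lambda>_. undefined)" for f :: "_ \<Rightarrow> real"
    by (simp add: PiM_empty lebesgue_integral_count_space_finite)
  then show ?case by simp
next
  case (insert i I)
  let ?P = "PiM I M" and ?Q = "PiM (insert i I) M"
  note [measurable] = insert.prems(1)
  have [measurable]: "g j \<in> borel_measurable ?Q" if "j \<in> insert i I" for j
    using insert.prems(2) that by blast
  note hB = insert.prems(3) and gB = insert.prems(4) and gi = insert.prems(5)
  interpret P: prob_space ?P by (rule prob_space_PiM) (rule M)
  interpret i: prob_space "M i" by (rule M)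
  note upd = fun_upd_in_space_PiM[where I=I and M=M and i=i]
  note mupd = measurable_fun_upd_PiM(2)[OF insert.hyps(2)]
  note mint = measurable_integral_fun_upd[OF M insert.hyps(1,2)]
  note irev = integral_PiM_insert_rev[OF M insert.hyps(1,2)]
  define B' where "B' = exp B * (2 * B + 1) + exp B"
  have e: "exp (h x) \<le> exp B" "exp (- B) \<le> exp (h x)" if "x \<in> space ?Q" for x
    using hB[OF that] by auto
  have eg: "exp (g j x) \<le> exp B" if "x \<in> space ?Q" "j \<in> insert i I" for x j
    using gB[OF that(2,1)] by auto
  have hh: "\<bar>exp (h x) * h x\<bar> \<le> exp B * B" if "x \<in> space ?Q" for x
    unfolding abs_mult by (rule mult_mono) (use e[OF that] hB[OF that] in auto)
  have gg: "\<bar>exp (h x) * (h x - g j x - 1) + exp (g j x)\<bar> \<le> B'"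
    if "x \<in> space ?Q" "j \<in> insert i I" for x j
  proof -
    have "\<bar>exp (h x) * (h x - g j x - 1)\<bar> \<le> exp B * (2 * B + 1)"
      unfolding abs_mult by (rule mult_mono) (use e[OF that(1)] hB[OF that(1)] gB[OF that(2,1)] in auto)
    then show ?thesis unfolding B'_def using eg[OF that] exp_gt_zero[of "g j x"] by linarith
  qed
  \<comment> \<open>\<open>F\<close> is the marginal of \<open>exp h\<close> in the coordinate
    \<open>i\<close> and \<open>c\<close> its total mass; \<open>H\<close> and \<open>G j\<close>
    are the matching partial integrals of the other terms of the claim.\<close>
  define F where "F y = (\<integral>x. exp (h (x(i := y))) \<partial>?P)" for y
  define G where "G j y = (\<integral>x. exp (h (x(i := y))) * (h (x(i := y)) - g j (x(i := y)) - 1)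
      + exp (g j (x(i := y))) \<partial>?P)" for j y
  define H where "H y = (\<integral>x. exp (h (x(i := y))) * h (x(i := y)) \<partial>?P)" for y
  define c where "c = (\<integral>y. F y \<partial>M i)"
  have [measurable]: "F \<in> borel_measurable (M i)" "H \<in> borel_measurable (M i)"
    unfolding F_def H_def by (rule mint, measurable)+
  have [measurable]: "G j \<in> borel_measurable (M i)" if "j \<in> insert i I" for j
    unfolding G_def by (rule mint) (use that in measurable)
  \<comment> \<open>Boundedness of \<open>h\<close> keeps \<open>F\<close> away from zero, so
    \<open>ln (F y)\<close> and later \<open>ln c\<close> are genuine logarithms.\<close>
  have Fb: "exp (- B) \<le> F y" "F y \<le> exp B" if "y \<in> space (M i)" for y
  proof -
    have int: "integrable ?P (\<lambda>x. exp (h (x(i := y))))"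
      by (rule integrable_bounded[OF P.prob_space_axioms, of _ "exp B"])
        (use mupd[OF insert.prems(1) that] e upd that in auto)
    have "(\<integral>x. exp (- B) \<partial>?P) \<le> F y" "F y \<le> (\<integral>x. exp B \<partial>?P)"
      unfolding F_def by (rule integral_mono; use int e upd that in auto)+
    then show "exp (- B) \<le> F y" "F y \<le> exp B" by (simp_all add: P.prob_space)
  qed
  have Fpos: "0 < F y" if "y \<in> space (M i)" for y
    using Fb(1)[OF that] exp_gt_zero[of "-B"] by linarith
  have intF: "integrable (M i) F"
    by (rule integrable_bounded[OF M, of _ _ "exp B"]) (use Fb Fpos in \<open>simp_all add: abs_of_pos\<close>)
  have c: "exp (- B) \<le> c"
  proof -
    have "(\<integral>x. exp (- B) \<partial>M i) \<le> c" unfolding c_def by (rule integral_mono) (use intF Fb in auto)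
    then show ?thesis by (simp add: i.prob_space)
  qed
  then have c0: "0 < c" using exp_gt_zero[of "-B"] by linarith
  have intH: "integrable (M i) H"
    unfolding H_def
    by (rule integrable_bounded[OF M, of _ _ "exp B * B"])
      (use \<open>H \<in> borel_measurable (M i)\<close> in \<open>simp add: H_def\<close>,
       rule abs_integral_le_bound[OF P.prob_space_axioms],
       use mupd[OF insert.prems(1)] hh upd in auto)
  have intG: "integrable (M i) (G j)" if j: "j \<in> insert i I" for j
  proof (rule integrable_bounded[OF M, of _ _ B'])
    show "\<bar>G j y\<bar> \<le> B'" if y: "y \<in> space (M i)" for y
      unfolding G_def
      by (rule abs_integral_le_bound[OF P.prob_space_axioms])
        (use mupd[OF insert.prems(1) y] mupd[OF insert.prems(2)[OF j] y] gg upd y j in auto)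
  qed (use j in simp)
  have IH: "H y - F y * ln (F y) \<le> (\<Sum>j\<in>I. G j y)" if y: "y \<in> space (M i)" for y
    unfolding F_def G_def H_def
  proof (rule insert.IH)
    show "(\<lambda>x. h (x(i := y))) \<in> borel_measurable ?P" by (rule mupd) (use y in auto)
    show "(\<lambda>x. g j (x(i := y))) \<in> borel_measurable ?P" if "j \<in> I" for j
      by (rule mupd) (use y that in auto)
    show "g j ((x(j := z))(i := y)) = g j (x(i := y))"
      if "j \<in> I" "x \<in> space ?P" "z \<in> space (M j)" for j x z
      using gi[of j "x(i := y)" z] that upd[OF that(2) y] insert.hyps(2)
      by (metis fun_upd_twist insertI2)
    show "\<bar>h (x(i := y))\<bar> \<le> B" if "x \<in> space ?P" for x
      using hB upd[OF that y] by blast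
    show "\<bar>g j (x(i := y))\<bar> \<le> B" if "j \<in> I" "x \<in> space ?P" for j x
      using gB upd[OF that(2) y] that(1) by blast
  qed
  \<comment> \<open>As \<open>g i\<close> does not depend on the coordinate \<open>i\<close>, the
    partial integral of \<open>exp (g i)\<close> is one constant, named \<open>k\<close> below, for
    all values of that coordinate.\<close>
  have K: "(\<integral>x. exp (g i (x(i := y))) \<partial>?P) = (\<integral>x. exp (g i (x(i := z))) \<partial>?P)"
    if "y \<in> space (M i)" "z \<in> space (M i)" for y z
  proof (rule Bochner_Integration.integral_cong[OF refl])
    show "exp (g i (x(i := y))) = exp (g i (x(i := z)))" if "x \<in> space ?P" for x
      using gi[OF insertI1 upd[OF that \<open>y \<in> space (M i)\<close>] \<open>z \<in> space (M i)\<close>]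
      by (simp only: fun_upd_upd)
  qed
  obtain z where z: "z \<in> space (M i)" using i.not_empty by blast
  define k where "k = (\<integral>x. exp (g i (x(i := z))) \<partial>?P)"
  \<comment> \<open>Gibbs' inequality with \<open>a = h\<close> and
    \<open>b = exp (g i) * (F y / c)\<close>, integrated over the remaining coordinates. The factor
    \<open>F y / c\<close> is the normalised marginal density.\<close>
  have step: "F y * ln (F y) - F y * ln c + k - k * F y / c \<le> G i y" if y: "y \<in> space (M i)" for y
  proof -
    let ?u = "\<lambda>x. x(i := y)"
    have m: "(\<lambda>x. h (?u x)) \<in> borel_measurable ?P" "(\<lambda>x. g i (?u x)) \<in> borel_measurable ?P"
      by (rule mupd; use y in auto)+
    have i1: "integrable ?P (\<lambda>x. exp (h (?u x)))"
      by (rule integrable_bounded[OF P.prob_space_axioms, of _ "exp B"]) (use m e upd y in auto)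
    have i2: "integrable ?P (\<lambda>x. exp (g i (?u x)))"
      by (rule integrable_bounded[OF P.prob_space_axioms, of _ "exp B"]) (use m eg upd y in auto)
    have i3: "integrable ?P (\<lambda>x. exp (h (?u x)) * (h (?u x) - g i (?u x) - 1) + exp (g i (?u x)))"
      by (rule integrable_bounded[OF P.prob_space_axioms, of _ B']) (use m gg upd y in auto)
    have "exp (h (?u x)) * ln (F y / c) + (1 - F y / c) * exp (g i (?u x))
        \<le> exp (h (?u x)) * (h (?u x) - g i (?u x) - 1) + exp (g i (?u x))"
      if "x \<in> space ?P" for x
    proof -
      have p: "0 < exp (g i (?u x)) * (F y / c)" using Fpos[OF y] c0 by simp
      have "ln (exp (g i (?u x)) * (F y / c)) = g i (?u x) + ln (F y / c)"
        using Fpos[OF y] c0 by (subst ln_mult) auto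
      with gibbs_pointwise[OF p, of "h (?u x)"] show ?thesis
        by (simp add: algebra_simps)
    qed
    then have "(\<integral>x. exp (h (?u x)) * ln (F y / c) + (1 - F y / c) * exp (g i (?u x)) \<partial>?P) \<le> G i y"
      unfolding G_def by (intro integral_mono) (use i1 i2 i3 in auto)
    moreover have "(\<integral>x. exp (h (?u x)) * ln (F y / c) + (1 - F y / c) * exp (g i (?u x)) \<partial>?P)
        = F y * ln (F y / c) + (1 - F y / c) * k"
      using i1 i2 unfolding k_def F_def K[OF z y] by simp
    moreover have "ln (F y / c) = ln (F y) - ln c"
      using Fpos[OF y] c0 by (simp add: ln_div)
    ultimately show ?thesis by (simp add: algebra_simps)
  qed
  \<comment> \<open>Adding \<open>IH\<close> and \<open>step\<close> cancels
    \<open>F y * ln (F y)\<close>. Integration over \<open>y\<close> then cancels the two terms with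
    \<open>k\<close>, since \<open>F\<close> has integral \<open>c\<close>, and leaves exactly the
    entropy.\<close>
  have "H y - F y * ln c + k - k * F y / c \<le> (\<Sum>j\<in>insert i I. G j y)" if "y \<in> space (M i)" for y
    using IH[OF that] step[OF that] insert.hyps by simp
  then have "(\<integral>y. H y - F y * ln c + k - k * F y / c \<partial>M i) \<le> (\<integral>y. (\<Sum>j\<in>insert i I. G j y) \<partial>M i)"
    by (intro integral_mono) (use intF intH intG in auto)
  moreover have "(\<integral>y. H y - F y * ln c + k - k * F y / c \<partial>M i) = (\<integral>y. H y \<partial>M i) - c * ln c"
    using intF intH c0 by (simp add: i.prob_space c_def[symmetric])
  moreover have "(\<integral>y. (\<Sum>j\<in>insert i I. G j y) \<partial>M i) = (\<Sum>j\<in>insert i I. \<integral>y. G j y \<partial>M i)"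
    by (rule Bochner_Integration.integral_sum) (use intG in auto)
  moreover have "(\<integral>x. exp (h x) * h x \<partial>?Q) = (\<integral>y. H y \<partial>M i)"
    unfolding H_def by (rule irev[where B="exp B * B"]) (use hh in auto)
  moreover have "(\<integral>x. exp (h x) \<partial>?Q) = c"
    unfolding c_def F_def by (rule irev[where B="exp B"]) (use e in auto)
  moreover have "(\<integral>x. exp (h x) * (h x - g j x - 1) + exp (g j x) \<partial>?Q) = (\<integral>y. G j y \<partial>M i)"
    if "j \<in> insert i I" for j
    unfolding G_def by (rule irev[where B="B'"]) (use gg that in auto)
  ultimately show ?case by simp
qed

subsection \<open>Self-bounding functions\<close>

text \<open>
  In terms of \<open>ln F\<close> the hypothesis says that \<open>ln (F l) / (exp l - 1)\<close> is decreasing; its value at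
  \<open>0\<close> is \<open>F' 0\<close>.
\<close>

lemma entropy_ode_bound:
  fixes F F' :: "real \<Rightarrow> real"
  assumes deriv: "\<And>l. (F has_real_derivative F' l) (at l)"
    and pos: "\<And>l. 0 < F l" and "F 0 = 1"
    and ineq: "\<And>l. (1 - exp (- l)) * F' l \<le> F l * ln (F l)"
  shows "F l \<le> exp ((exp l - 1) * F' 0)"
proof -
  \<comment> \<open>The quotient is extended to \<open>0\<close> by its limit there, so that
    monotonicity on either side reaches the value \<open>F' 0\<close>.\<close>
  define G where "G l = (if l = 0 then F' 0 else ln (F l) / (exp l - 1))" for l
  have dlnF: "((\<lambda>l. ln (F l)) has_real_derivative F' l / F l) (at l)" for l
    by (auto intro!: derivative_eq_intros deriv pos simp: pos[THEN less_imp_neq, symmetric] divide_simps)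
  have dG: "(G has_real_derivative
      (F' l / F l * (exp l - 1) - ln (F l) * exp l) / (exp l - 1)\<^sup>2) (at l)" if "l \<noteq> 0" for l
  proof -
    have "((\<lambda>l. ln (F l) / (exp l - 1)) has_real_derivative
      (F' l / F l * (exp l - 1) - ln (F l) * exp l) / (exp l - 1)\<^sup>2) (at l)"
      using DERIV_divide[OF dlnF[of l] DERIV_diff[OF DERIV_exp DERIV_const[of 1]]] that
      by (simp add: power2_eq_square)
    moreover have "\<forall>\<^sub>F x in nhds l. G x = ln (F x) / (exp x - 1)"
      using t1_space_nhds[OF that] by eventually_elim (simp add: G_def)
    ultimately show ?thesis by (subst DERIV_cong_ev[OF refl _ refl]) auto
  qed
  \<comment> \<open>The numerator is nonpositive by \<open>ineq\<close>, multiplied by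
    \<open>exp l / F l\<close>.\<close>
  have neg: "(F' l / F l * (exp l - 1) - ln (F l) * exp l) / (exp l - 1)\<^sup>2 \<le> 0" for l
  proof -
    have "F' l * (exp l - 1) = exp l * ((1 - exp (- l)) * F' l)"
      by (simp add: algebra_simps exp_minus)
    also have "\<dots> \<le> exp l * (F l * ln (F l))"
      by (rule mult_left_mono[OF ineq]) simp
    finally have "F' l / F l * (exp l - 1) \<le> ln (F l) * exp l"
      using pos[of l] by (simp add: field_simps)
    then show ?thesis by (simp add: divide_le_0_iff)
  qed
  have "isCont G l" for l
  proof (cases "l = 0")
    case True
    \<comment> \<open>Near \<open>0\<close>, \<open>G\<close> is the quotient of the difference
      quotients of \<open>ln F\<close> and \<open>exp\<close>, both taken at
      \<open>0\<close>.\<close>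
    have "(\<lambda>h. (ln (F (0 + h)) - ln (F 0)) / h) \<midarrow>0\<rightarrow> F' 0 / F 0"
      using dlnF[of 0] by (simp add: DERIV_def)
    moreover have "(\<lambda>h. (exp (0 + h) - exp 0) / h) \<midarrow>0\<rightarrow> (1 :: real)"
      using DERIV_exp[of "0::real"] by (simp add: DERIV_def)
    ultimately have "(\<lambda>h. ((ln (F (0 + h)) - ln (F 0)) / h) / ((exp (0 + h) - exp 0) / h)) \<midarrow>0\<rightarrow> F' 0 / F 0 / 1"
      by (rule tendsto_divide) simp
    moreover have "\<forall>\<^sub>F h in at 0. ((ln (F (0 + h)) - ln (F 0)) / h) / ((exp (0 + h) - exp 0) / h) = G h"
      unfolding eventually_at_filter by (rule always_eventually) (auto simp: G_def \<open>F 0 = 1\<close>)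
    ultimately have "G \<midarrow>0\<rightarrow> F' 0"
      using tendsto_cong by (force simp: \<open>F 0 = 1\<close>)
    then show ?thesis using True by (simp add: isCont_def G_def)
  qed (use dG DERIV_isCont in blast)
  then have cont: "continuous_on S G" for S
    by (simp add: continuous_at_imp_continuous_on)
  \<comment> \<open>The derivative is available only off \<open>0\<close>, so the interval must lie
    on one side of \<open>0\<close>; continuity takes care of an endpoint at
    \<open>0\<close>.\<close>
  have mono: "G b \<le> G a" if "a \<le> b" "b \<le> 0 \<or> 0 \<le> a" for a b
  proof (rule DERIV_nonpos_imp_decreasing_open[OF that(1) _ cont])
    fix x assume "a < x" "x < b"
    with that have "x \<noteq> 0" by auto
    from dG[OF this] neg show "\<exists>y. (G has_real_derivative y) (at x) \<and> y \<le> 0" by blast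
  qed
  show ?thesis
  proof (cases "l = 0")
    case False
    have "ln (F l) \<le> (exp l - 1) * F' 0"
    proof (cases "l > 0")
      case True
      have "G l \<le> G 0"
        by (rule mono) (use True in auto)
      then show ?thesis using True by (simp add: G_def divide_le_eq mult.commute)
    next
      case nl: False
      \<comment> \<open>For negative \<open>l\<close> the order is reversed, but so is the sign of
        \<open>exp l - 1\<close>, and the same upper bound on \<open>ln (F l)\<close>
        results.\<close>
      have "G 0 \<le> G l"
        by (rule mono) (use nl in auto)
      then show ?thesis using False nl by (simp add: G_def le_divide_eq mult.commute split: if_splits)
    qed
    then show ?thesis using pos[of l] by (metis exp_le_cancel_iff exp_ln)
  qed (simp add: \<open>F 0 = 1\<close>)
qed

text \<open>Moment generating functions become finite sums of exponentials, which can be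
  differentiated term by term in \<open>l\<close> without interchanging limit and integral.\<close>

lemma integral_bounded_nat:
  fixes Z :: "'a \<Rightarrow> nat" and g :: "nat \<Rightarrow> real"
  assumes P: "prob_space P" and Z: "Z \<in> measurable P (count_space UNIV)"
    and N: "\<And>x. x \<in> space P \<Longrightarrow> Z x \<le> N"
  shows "(\<integral>x. g (Z x) \<partial>P) = (\<Sum>j\<le>N. g j * measure P {x \<in> space P. Z x = j})"
proof -
  interpret prob_space P by fact
  note [measurable] = Z
  have "(\<integral>x. g (Z x) \<partial>P) = (\<integral>x. (\<Sum>j\<le>N. g j * indicator {x \<in> space P. Z x = j} x) \<partial>P)"
  proof (rule Bochner_Integration.integral_cong[OF refl])
    fix x assume x: "x \<in> space P"
    have "(\<Sum>j\<le>N. g j * indicator {x \<in> space P. Z x = j} x) = (\<Sum>j\<le>N. if j = Z x then g j else 0)"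
      using x by (intro sum.cong) (auto simp: indicator_def)
    then show "g (Z x) = (\<Sum>j\<le>N. g j * indicator {x \<in> space P. Z x = j} x)"
      using N[OF x] by simp
  qed
  also have "\<dots> = (\<Sum>j\<le>N. g j * measure P {x \<in> space P. Z x = j})"
    by (subst Bochner_Integration.integral_sum) (auto intro!: integrable_real_indicator simp: less_top[symmetric])
  finally show ?thesis .
qed

text \<open>Entropy tensorization is applied to \<open>h = l Z\<close> and
  \<open>g i = l (W i)\<close>. Since \<open>Z - W i\<close> is \<open>0\<close> or
  \<open>1\<close>, each entropy term is a constant times \<open>exp (l Z) (Z - W i)\<close>, and
  \<open>sb\<close> bounds their sum. The result is the differential inequality of
  \<open>entropy_ode_bound\<close>.\<close>

theorem self_bounding_mgf_le:
  fixes Z :: "('i \<Rightarrow> 'a) \<Rightarrow> nat" and W :: "'i \<Rightarrow> ('i \<Rightarrow> 'a) \<Rightarrow> nat"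
  assumes M: "\<And>i. prob_space (M i)" and I: "finite I"
    and Z: "Z \<in> measurable (PiM I M) (count_space UNIV)"
    and W: "\<And>i. i \<in> I \<Longrightarrow> W i \<in> measurable (PiM I M) (count_space UNIV)"
    and N: "\<And>x. x \<in> space (PiM I M) \<Longrightarrow> Z x \<le> N"
    and WZ: "\<And>i x. i \<in> I \<Longrightarrow> x \<in> space (PiM I M) \<Longrightarrow> W i x \<le> Z x \<and> Z x \<le> Suc (W i x)"
    and sb: "\<And>x. x \<in> space (PiM I M) \<Longrightarrow> (\<Sum>i\<in>I. Z x - W i x) \<le> Z x"
    and indep: "\<And>i x y. i \<in> I \<Longrightarrow> x \<in> space (PiM I M) \<Longrightarrow> y \<in> space (M i) \<Longrightarrow> W i (x(i := y)) = W i x"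
  shows "(\<integral>x. exp (l * real (Z x)) \<partial>PiM I M) \<le> exp ((exp l - 1) * (\<integral>x. real (Z x) \<partial>PiM I M))"
proof -
  let ?P = "PiM I M"
  have P: "prob_space ?P" by (rule prob_space_PiM) (rule M)
  interpret prob_space ?P by (rule P)
  note [measurable] = Z W
  define p where "p j = measure ?P {x \<in> space ?P. Z x = j}" for j
  have int: "(\<integral>x. g (Z x) \<partial>?P) = (\<Sum>j\<le>N. g j * p j)" for g :: "nat \<Rightarrow> real"
    unfolding p_def by (rule integral_bounded_nat[OF P Z N])
  define F where "F l = (\<Sum>j\<le>N. exp (l * real j) * p j)" for l
  define F' where "F' l = (\<Sum>j\<le>N. exp (l * real j) * real j * p j)" for l
  have F: "(\<integral>x. exp (l * real (Z x)) \<partial>?P) = F l" for l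
    unfolding F_def by (rule int)
  have F': "(\<integral>x. exp (l * real (Z x)) * real (Z x) \<partial>?P) = F' l" for l
    unfolding F'_def by (rule int)
  have bdd: "integrable ?P (\<lambda>x. g (Z x))" for g :: "nat \<Rightarrow> real"
    by (rule integrable_bounded[OF P, of _ "Max ((\<lambda>j. \<bar>g j\<bar>) ` {..N})"]) (use N in auto)
  have Fpos: "0 < F l" for l
  proof -
    have "(\<integral>x. exp (- (\<bar>l\<bar> * real N)) \<partial>?P) \<le> (\<integral>x. exp (l * real (Z x)) \<partial>?P)"
    proof (rule integral_mono)
      show "exp (- (\<bar>l\<bar> * real N)) \<le> exp (l * real (Z x))" if "x \<in> space ?P" for x
      proof -
        have "\<bar>l * real (Z x)\<bar> \<le> \<bar>l\<bar> * real N"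
          unfolding abs_mult by (rule mult_left_mono) (use N[OF that] in auto)
        then show ?thesis by simp
      qed
    qed (use bdd in auto)
    then have "exp (- (\<bar>l\<bar> * real N)) \<le> F l" by (simp add: F prob_space)
    then show ?thesis using exp_gt_zero[of "- (\<bar>l\<bar> * real N)"] by linarith
  qed
  have ent: "(1 - exp (- l)) * F' l \<le> F l * ln (F l)" for l
  proof -
    \<comment> \<open>The entropy term equals \<open>exp (l Z)\<close> times this constant when
      \<open>Z = W i + 1\<close>, and it vanishes when \<open>Z = W i\<close>.\<close>
    define c where "c = l - 1 + exp (- l)"
    have c: "0 \<le> c" using exp_ge_add_one_self[of "-l"] by (simp add: c_def)
    have B: "\<bar>l * real m\<bar> \<le> \<bar>l\<bar> * real N" if "m \<le> N" for m
      unfolding abs_mult using that by (intro mult_left_mono) auto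
    have WN: "W i x \<le> N" if "i \<in> I" "x \<in> space ?P" for i x
      using WZ[OF that] N[OF that(2)] by linarith
    have "(\<integral>x. exp (l * real (Z x)) * (l * real (Z x)) \<partial>?P) - F l * ln (F l)
      \<le> (\<Sum>i\<in>I. \<integral>x. exp (l * real (Z x)) * (l * real (Z x) - l * real (W i x) - 1) + exp (l * real (W i x)) \<partial>?P)"
      unfolding F[symmetric]
      by (rule entropy_tensorization[OF M I, where B="\<bar>l\<bar> * real N"])
        (use B N WN indep in auto)
    also have "\<dots> = (\<Sum>i\<in>I. \<integral>x. c * (exp (l * real (Z x)) * real (Z x - W i x)) \<partial>?P)"
    proof (intro sum.cong refl Bochner_Integration.integral_cong)
      fix i x assume *: "i \<in> I" "x \<in> space ?P"
      from WZ[OF this] consider "Z x = W i x" | "Z x = Suc (W i x)" by linarith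
      then show "exp (l * real (Z x)) * (l * real (Z x) - l * real (W i x) - 1) + exp (l * real (W i x))
        = c * (exp (l * real (Z x)) * real (Z x - W i x))"
      proof cases
        case 2
        have "exp (l * real (W i x)) = exp (l * real (Z x)) * exp (- l)"
          unfolding exp_add[symmetric] 2 by (simp add: algebra_simps)
        then show ?thesis by (simp add: 2 c_def algebra_simps)
      qed simp
    qed
    also have "\<dots> = (\<integral>x. c * (\<Sum>i\<in>I. exp (l * real (Z x)) * real (Z x - W i x)) \<partial>?P)"
    proof -
      have "integrable ?P (\<lambda>x. exp (l * real (Z x)) * real (Z x - W i x))" if "i \<in> I" for i
      proof (rule integrable_bounded[OF P, of _ "exp (\<bar>l\<bar> * real N) * real N"])
        show "\<bar>exp (l * real (Z x)) * real (Z x - W i x)\<bar> \<le> exp (\<bar>l\<bar> * real N) * real N"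
          if "x \<in> space ?P" for x
          unfolding abs_mult by (intro mult_mono) (use B[OF N[OF that]] N[OF that] in auto)
      qed (use that in measurable)
      then show ?thesis by (subst Bochner_Integration.integral_sum[symmetric]) (auto simp: sum_distrib_left)
    qed
    \<comment> \<open>Here the self-bounding property enters; \<open>c \<ge> 0\<close> preserves the
      direction of the inequality for both signs of \<open>l\<close>.\<close>
    also have "\<dots> \<le> (\<integral>x. c * (exp (l * real (Z x)) * real (Z x)) \<partial>?P)"
    proof (rule Bochner_Integration.integral_mono')
      show "integrable ?P (\<lambda>x. c * (exp (l * real (Z x)) * real (Z x)))"
        by (rule bdd)
      show "c * (\<Sum>i\<in>I. exp (l * real (Z x)) * real (Z x - W i x)) \<le> c * (exp (l * real (Z x)) * real (Z x))"
        if "x \<in> space ?P" for x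
      proof -
        have "real (\<Sum>i\<in>I. Z x - W i x) \<le> real (Z x)" using sb[OF that] by linarith
        then show ?thesis
          unfolding sum_distrib_left[symmetric] of_nat_sum by (intro mult_left_mono c) auto
      qed
      show "0 \<le> c * (exp (l * real (Z x)) * real (Z x))" for x
        using c by simp
    qed
    also have "\<dots> = c * F' l" by (simp add: F'[symmetric])
    finally have "(\<integral>x. exp (l * real (Z x)) * (l * real (Z x)) \<partial>?P) - F l * ln (F l) \<le> c * F' l" .
    moreover have "(\<integral>x. exp (l * real (Z x)) * (l * real (Z x)) \<partial>?P) = l * F' l"
      unfolding F'[symmetric] by (subst integral_mult_right_zero[symmetric]) (simp add: mult_ac)
    \<comment> \<open>With \<open>c = l - 1 + exp (- l)\<close> the terms \<open>l * F' l\<close>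
      cancel, which leaves the claimed factor \<open>1 - exp (- l)\<close>.\<close>
    ultimately have "l * F' l - F l * ln (F l) \<le> c * F' l" by simp
    then show ?thesis by (simp add: c_def algebra_simps)
  qed
  have "F l \<le> exp ((exp l - 1) * F' 0)"
  proof (rule entropy_ode_bound[OF _ Fpos _ ent])
    show "(F has_real_derivative F' l) (at l)" for l
      unfolding F_def F'_def by (auto intro!: derivative_eq_intros sum.cong)
    show "F 0 = 1" using F[of 0] by (simp add: prob_space)
  qed
  then show ?thesis using F F'[of 0] by simp
qed

section \<open>From the moment generating function to tail bounds\<close>

lemma exp_le_quadratic:
  fixes x :: real
  assumes "\<bar>x\<bar> \<le> 1"
  shows "exp x \<le> 1 + x + x\<^sup>2"
proof (cases "0 \<le> x")
  case False
  \<comment> \<open>For negative \<open>x\<close> the claim is equivalent to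
    \<open>1 \<le> (1 + x + x^2) exp (- x)\<close>, and the Taylor lower bound is available at the
    positive argument \<open>- x\<close>.\<close>
  then have "(1 + x + x\<^sup>2) * exp (- x) \<ge> (1 + x + x\<^sup>2) * (1 + (- x) + (- x)\<^sup>2 / 2)"
    using assms by (intro mult_left_mono exp_lower_Taylor_quadratic) auto
  moreover have "(1 + x + x\<^sup>2) * (1 + (- x) + (- x)\<^sup>2 / 2) = 1 + x\<^sup>2 / 2 * (1 - x + x\<^sup>2)"
    by (simp add: field_simps power2_eq_square)
  moreover have "0 \<le> x\<^sup>2 / 2 * (1 - x + x\<^sup>2)" using False by (intro mult_nonneg_nonneg) auto
  ultimately have "1 \<le> (1 + x + x\<^sup>2) * exp (- x)" by linarith
  then show ?thesis by (simp add: exp_minus field_simps)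
qed (use assms exp_bound in auto)

text \<open>Chernoff's bound at \<open>l = \<plusminus> t / (2 \<mu>)\<close>.\<close>

lemma poisson_mgf_concentration:
  fixes Z :: "'a \<Rightarrow> real"
  assumes P: "prob_space P" and Z: "Z \<in> borel_measurable P"
    and int: "\<And>l. integrable P (\<lambda>x. exp (l * Z x))"
    and mgf: "\<And>l. (\<integral>x. exp (l * Z x) \<partial>P) \<le> exp ((exp l - 1) * \<mu>)"
    and "0 < \<mu>" "0 \<le> t" "t \<le> 2 * \<mu>"
  shows "measure P {x \<in> space P. \<bar>Z x - \<mu>\<bar> \<ge> t} \<le> 2 * exp (- (t\<^sup>2 / (4 * \<mu>)))"
proof -
  interpret prob_space P by fact
  note [measurable] = Z
  \<comment> \<open>The sign of \<open>s\<close> selects the tail. The assumption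
    \<open>t \<le> 2 * \<mu>\<close> gives \<open>\<bar>s\<bar> \<le> 1\<close>, as the quadratic
    bound on \<open>exp s\<close> requires.\<close>
  have chernoff: "prob {x \<in> space P. \<bar>s\<bar> * t \<le> s * (Z x - \<mu>)} \<le> exp (- (t\<^sup>2 / (4 * \<mu>)))"
    if s: "\<bar>s\<bar> = t / (2 * \<mu>)" for s
  proof -
    have "prob {x \<in> space P. \<bar>s\<bar> * t \<le> s * (Z x - \<mu>)}
        = prob {x \<in> space P. exp (s * \<mu> + \<bar>s\<bar> * t) \<le> exp (s * Z x)}"
      by (rule arg_cong[of _ _ prob]) (auto simp: algebra_simps)
    also have "\<dots> \<le> (\<integral>x. exp (s * Z x) \<partial>P) / exp (s * \<mu> + \<bar>s\<bar> * t)"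
      by (rule integral_Markov_inequality_measure[where A="space P"]) (use int in auto)
    also have "\<dots> \<le> exp ((exp s - 1) * \<mu>) / exp (s * \<mu> + \<bar>s\<bar> * t)"
      by (rule divide_right_mono[OF mgf]) simp
    also have "\<dots> = exp ((exp s - 1 - s) * \<mu> - \<bar>s\<bar> * t)"
      by (simp add: exp_diff[symmetric] algebra_simps)
    also have "\<dots> \<le> exp (s\<^sup>2 * \<mu> - \<bar>s\<bar> * t)"
      using exp_le_quadratic[of s] s assms(5-) by simp
    also have "s\<^sup>2 * \<mu> - \<bar>s\<bar> * t = - (t\<^sup>2 / (4 * \<mu>))"
      unfolding power2_abs[of s, symmetric] s using \<open>0 < \<mu>\<close> by (simp add: field_simps power2_eq_square)
    finally show ?thesis .
  qed
  define s where "s = t / (2 * \<mu>)"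
  have s: "0 \<le> s" using assms(5-) by (simp add: s_def)
  have "prob {x \<in> space P. \<bar>Z x - \<mu>\<bar> \<ge> t}
    \<le> prob ({x \<in> space P. \<bar>s\<bar> * t \<le> s * (Z x - \<mu>)} \<union> {x \<in> space P. \<bar>- s\<bar> * t \<le> - s * (Z x - \<mu>)})"
  proof (rule finite_measure_mono)
    show "{x \<in> space P. \<bar>Z x - \<mu>\<bar> \<ge> t}
      \<subseteq> {x \<in> space P. \<bar>s\<bar> * t \<le> s * (Z x - \<mu>)} \<union> {x \<in> space P. \<bar>- s\<bar> * t \<le> - s * (Z x - \<mu>)}"
    proof
      fix x assume x: "x \<in> {x \<in> space P. \<bar>Z x - \<mu>\<bar> \<ge> t}"
      then have "t \<le> Z x - \<mu> \<or> t \<le> - (Z x - \<mu>)" by auto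
      then have "s * t \<le> s * (Z x - \<mu>) \<or> s * t \<le> s * (- (Z x - \<mu>))"
        using mult_left_mono[OF _ s] by blast
      then show "x \<in> {x \<in> space P. \<bar>s\<bar> * t \<le> s * (Z x - \<mu>)} \<union> {x \<in> space P. \<bar>- s\<bar> * t \<le> - s * (Z x - \<mu>)}"
        using x s by (auto simp: abs_of_nonneg algebra_simps)
    qed
  qed measurable
  also have "\<dots> \<le> prob {x \<in> space P. \<bar>s\<bar> * t \<le> s * (Z x - \<mu>)} + prob {x \<in> space P. \<bar>- s\<bar> * t \<le> - s * (Z x - \<mu>)}"
    by (rule measure_Un_le) measurable
  also have "\<dots> \<le> exp (- (t\<^sup>2 / (4 * \<mu>))) + exp (- (t\<^sup>2 / (4 * \<mu>)))"
    by (rule add_mono; rule chernoff) (use s in \<open>simp_all flip: s_def\<close>)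
  finally show ?thesis by simp
qed

subsection \<open>Configuration functions\<close>

text \<open>Indices outside \<open>K\<close> contribute \<open>0\<close> and indices inside at most
  \<open>1\<close>. In the application \<open>K\<close> is a largest good set.\<close>

lemma sum_bounded_by_maximizer:
  fixes w :: "'i \<Rightarrow> nat"
  assumes "finite I" "K \<subseteq> I" "card K = z" and "\<And>i. i \<in> I - K \<Longrightarrow> z \<le> w i"
    and "\<And>i. i \<in> I \<Longrightarrow> z \<le> Suc (w i)"
  shows "(\<Sum>i\<in>I. z - w i) \<le> z"
proof -
  have "(\<Sum>i\<in>I. z - w i) \<le> (\<Sum>i\<in>I. if i \<in> K then 1 else 0)"
    by (rule sum_mono) (use assms(4,5) in \<open>force simp: le_diff_conv\<close>)
  also have "\<dots> = card K"
    using assms(1,2) by (simp add: sum.If_cases Int_absorb1)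
  finally show ?thesis using assms(3) by simp
qed

text \<open>The quantifier ranges over the finite set \<open>Pow I\<close>, so measurability in a
  random \<open>good\<close> reduces to that of finitely many predicates.\<close>

definition max_card_below :: "'i set \<Rightarrow> ('i set \<Rightarrow> bool) \<Rightarrow> nat" where
  "max_card_below I good = Max {m. \<exists>K\<in>Pow I. card K = m \<and> good K}"

lemma max_card_below_cong:
  "(\<And>K. K \<subseteq> I \<Longrightarrow> good K = good' K) \<Longrightarrow> max_card_below I good = max_card_below I good'"
  unfolding max_card_below_def by (intro arg_cong[of _ _ Max]) auto

lemma finite_cards: "finite I \<Longrightarrow> finite {m. \<exists>K\<in>Pow I. card K = m \<and> good K}"
  by (rule finite_subset[of _ "card ` Pow I"]) auto

lemma max_card_below_ge:
  "finite I \<Longrightarrow> K \<subseteq> I \<Longrightarrow> good K \<Longrightarrow> card K \<le> max_card_below I good"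
  unfolding max_card_below_def by (rule Max_ge[OF finite_cards]) auto

lemma max_card_below_attained:
  assumes "finite I" "good {}"
  obtains K where "K \<subseteq> I" "good K" "card K = max_card_below I good"
proof -
  have "max_card_below I good \<in> {m. \<exists>K\<in>Pow I. card K = m \<and> good K}"
    unfolding max_card_below_def by (rule Max_in[OF finite_cards]) (use assms in auto)
  then show ?thesis using that by auto
qed

text \<open>Fix a largest good set \<open>K\<close>. Removing \<open>i\<close> from the ground set
  leaves \<open>K - {i}\<close> good by heredity, and leaves \<open>K\<close> itself available if
  \<open>i\<close> is not in \<open>K\<close>.\<close>

lemma max_card_below_remove:
  assumes I: "finite I" and "good {}" and hered: "\<And>K K'. good K \<Longrightarrow> K' \<subseteq> K \<Longrightarrow> good K'"
  shows "max_card_below (I - {i}) good \<le> max_card_below I good"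
    and "max_card_below I good \<le> Suc (max_card_below (I - {i}) good)"
    and "(\<Sum>i\<in>I. max_card_below I good - max_card_below (I - {i}) good) \<le> max_card_below I good"
proof -
  have fin: "finite (I - {i})" for i using I by simp
  obtain K where K: "K \<subseteq> I" "good K" "card K = max_card_below I good"
    using max_card_below_attained[OF I, of good] \<open>good {}\<close> by blast
  show "max_card_below (I - {i}) good \<le> max_card_below I good"
    by (rule max_card_below_attained[OF fin[of i], of good])
      (use \<open>good {}\<close> max_card_below_ge[OF I, of _ good] in \<open>auto, metis Diff_subset subset_trans\<close>)
  have le: "max_card_below I good \<le> Suc (max_card_below (I - {i}) good)" for i
  proof -
    have "card (K - {i}) \<le> max_card_below (I - {i}) good"
      by (rule max_card_below_ge[OF fin]) (use K hered in auto)
    moreover have "card K \<le> Suc (card (K - {i}))"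
      using finite_subset[OF K(1) I] by (simp add: card_Diff_singleton_if) arith
    ultimately show ?thesis using K(3) by linarith
  qed
  then show "max_card_below I good \<le> Suc (max_card_below (I - {i}) good)" .
  show "(\<Sum>i\<in>I. max_card_below I good - max_card_below (I - {i}) good) \<le> max_card_below I good"
  proof (rule sum_bounded_by_maximizer[OF I K(1,3) _ le])
    show "max_card_below I good \<le> max_card_below (I - {i}) good" if "i \<in> I - K" for i
      using max_card_below_ge[OF fin, of K i good] K that by auto
  qed
qed

text \<open>The self-bounding estimate is used with \<open>W i\<close> the maximum over subsets of
  \<open>I - {i}\<close>. By \<open>local\<close> this does not depend on coordinate
  \<open>i\<close>. The Poisson-type bound on the moment generating function then yields the
  tails.\<close>

theorem configuration_function_concentration:
  fixes good :: "('i \<Rightarrow> 'a) \<Rightarrow> 'i set \<Rightarrow> bool"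
  assumes M: "\<And>i. prob_space (M i)" and I: "finite I"
    and meas: "\<And>K. K \<subseteq> I \<Longrightarrow> Measurable.pred (PiM I M) (\<lambda>x. good x K)"
    and empty: "\<And>x. good x {}"
    and hered: "\<And>x K K'. good x K \<Longrightarrow> K' \<subseteq> K \<Longrightarrow> good x K'"
    and local: "\<And>x K i y. i \<notin> K \<Longrightarrow> good (x(i := y)) K = good x K"
  defines "Z \<equiv> \<lambda>x. max_card_below I (good x)"
  defines "\<mu> \<equiv> (\<integral>x. real (Z x) \<partial>PiM I M)"
  assumes t: "0 < \<mu>" "0 \<le> t" "t \<le> 2 * \<mu>"
  shows "measure (PiM I M) {x \<in> space (PiM I M). \<bar>real (Z x) - \<mu>\<bar> \<ge> t} \<le> 2 * exp (- (t\<^sup>2 / (4 * \<mu>)))"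
proof -
  have P: "prob_space (PiM I M)" by (rule prob_space_PiM) (rule M)
  have mm: "(\<lambda>x. max_card_below J (good x)) \<in> measurable (PiM I M) (count_space UNIV)" if "J \<subseteq> I" for J
  proof -
    have "finite J" using that I by (rule finite_subset)
    then have "Measurable.pred (PiM I M) (\<lambda>x. \<exists>K\<in>Pow J. card K = m \<and> good x K)" for m
      by (intro pred_intros_finite pred_intros_logic meas) (use that in auto)
    then show ?thesis unfolding max_card_below_def by (rule measurable_Max_nat)
  qed
  have Z: "Z \<in> measurable (PiM I M) (count_space UNIV)" unfolding Z_def by (rule mm) simp
  have N: "Z x \<le> card I" for x
    by (rule max_card_below_attained[OF I, of "good x"], rule empty)
      (metis Z_def card_mono[OF I])
  note remove = max_card_below_remove[where good = "good x" for x, OF I empty hered]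
  have mgf: "(\<integral>x. exp (l * real (Z x)) \<partial>PiM I M) \<le> exp ((exp l - 1) * \<mu>)" for l
    unfolding \<mu>_def
  proof (rule self_bounding_mgf_le[OF M I Z, where W = "\<lambda>i x. max_card_below (I - {i}) (good x)"])
    show "max_card_below (I - {i}) (good (x(i := y))) = max_card_below (I - {i}) (good x)" for i x y
      by (rule max_card_below_cong) (use local in blast)
  qed (use mm remove N in \<open>auto simp: Z_def\<close>)
  show ?thesis
  proof (rule poisson_mgf_concentration[OF P _ _ mgf t])
    note [measurable] = Z
    show "(\<lambda>x. real (Z x)) \<in> borel_measurable (PiM I M)" by simp
    show "integrable (PiM I M) (\<lambda>x. exp (l * real (Z x)))" for l
    proof (rule integrable_bounded[OF P, of _ "exp (\<bar>l\<bar> * card I)"])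
      show "\<bar>exp (l * real (Z x))\<bar> \<le> exp (\<bar>l\<bar> * card I)" for x
        using mult_mono[of l "\<bar>l\<bar>" "real (Z x)" "card I"] N[of x] by simp
    qed simp
  qed
qed

subsection \<open>Admissible chains\<close>

lemma set_subseq: "subseq xs ys \<Longrightarrow> set xs \<subseteq> set ys"
  by (auto simp: subseq_conv_nths dest: in_set_nthsD)

lemma sorted_wrt_subseq:
  assumes "subseq xs ys" "sorted_wrt P ys"
  shows "sorted_wrt P xs"
  using assms by (induction rule: list_emb.induct) (auto dest: set_mp[OF set_subseq])

lemma count_list_subseq: "subseq xs ys \<Longrightarrow> count_list xs y \<le> count_list ys y"
  unfolding count_list_eq_length_filter
  by (rule list_emb_length[OF subseq_filter])

text \<open>Multiplicities can only drop in a sublist, and its tuples are tuples of the whole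
  list.\<close>

lemma k_monotone_subseq: "subseq qs ps \<Longrightarrow> k_monotone k ps \<Longrightarrow> k_monotone k qs"
  unfolding k_monotone_def
  by (meson count_list_subseq less_le_trans set_subseq subsetD sorted_wrt_subseq subseq_order.trans)

lemma admissible_chain_subseq:
  assumes "subseq qs ps" "admissible_chain k ps"
  shows "admissible_chain k qs"
proof -
  have 1: "subseq (\<gamma> k 0 # qs @ [\<gamma> k 1]) (\<gamma> k 0 # ps @ [\<gamma> k 1])"
    "subseq (replicate k (\<gamma> k 0) @ qs @ replicate k (\<gamma> k 1)) (replicate k (\<gamma> k 0) @ ps @ replicate k (\<gamma> k 1))"
    by (auto intro!: list_emb_append_mono assms(1))
  with assms(2) show ?thesis
    unfolding admissible_chain_def using sorted_wrt_subseq k_monotone_subseq by blast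
qed

text \<open>Chains are encoded by indices rather than points, so that they form a hereditary family
  over the coordinates of the random vector. The ordering is quantified away.\<close>

definition chain_index_set :: "nat \<Rightarrow> ('i \<Rightarrow> real \<times> real) \<Rightarrow> 'i set \<Rightarrow> bool" where
  "chain_index_set k y K \<longleftrightarrow> (\<exists>js. distinct js \<and> set js = K \<and> admissible_chain k (map y js))"

lemma chain_index_set_mono:
  assumes "chain_index_set k y K" "K' \<subseteq> K"
  shows "chain_index_set k y K'"
proof -
  obtain js where js: "distinct js" "set js = K" "admissible_chain k (map y js)"
    using assms(1) unfolding chain_index_set_def by blast
  have "admissible_chain k (map y (filter (\<lambda>i. i \<in> K') js))"
    by (rule admissible_chain_subseq[OF _ js(3)]) (intro subseq_map subseq_filter_left)
  then show ?thesis
    unfolding chain_index_set_def using js(1,2) assms(2)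
    by (intro exI[of _ "filter (\<lambda>i. i \<in> K') js"]) auto
qed

lemma chain_index_set_cong:
  assumes "\<And>i. i \<in> K \<Longrightarrow> y i = z i"
  shows "chain_index_set k y K = chain_index_set k z K"
proof -
  have "map y js = map z js" if "set js = K" for js
    using that assms by auto
  then show ?thesis unfolding chain_index_set_def by metis
qed

lemma admissible_chain_distinct:
  assumes "admissible_chain k ps"
  shows "distinct ps"
proof -
  have "sorted_wrt (\<lambda>p q. fst p < fst q) ps"
    using assms by (simp add: admissible_chain_def sorted_wrt_append)
  then show ?thesis by (induction ps) auto
qed

text \<open>Strictly increasing x-coordinates make the points of a chain distinct, so one index can
  be chosen per point and length equals cardinality. This holds for every outcome, including those
  with coinciding points.\<close>

lemma L_eq_max_card_below:
  "L k n Y \<omega> = max_card_below {..<n} (chain_index_set k (\<lambda>i. Y i \<omega>))"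
proof -
  let ?y = "\<lambda>i. Y i \<omega>"
  have "(\<exists>ps. m = length ps \<and> set ps \<subseteq> ?y ` {..<n} \<and> admissible_chain k ps) \<longleftrightarrow>
    (\<exists>K\<in>Pow {..<n}. card K = m \<and> chain_index_set k ?y K)" for m
  proof safe
    fix ps assume ps: "set ps \<subseteq> ?y ` {..<n}" "admissible_chain k ps"
    define js where "js = map (inv_into {..<n} ?y) ps"
    have map: "map ?y js = ps"
      unfolding js_def map_map by (rule map_idI) (use ps(1) in \<open>auto intro!: f_inv_into_f\<close>)
    have "distinct js"
      using admissible_chain_distinct[OF ps(2)] unfolding map[symmetric] by (simp add: distinct_map)
    moreover have "set js \<subseteq> {..<n}"
      unfolding js_def using ps(1) by (auto intro: inv_into_into[of _ ?y "{..<n}", simplified])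
    moreover have "length js = length ps"
      by (simp add: js_def)
    ultimately show "\<exists>K\<in>Pow {..<n}. card K = length ps \<and> chain_index_set k ?y K"
      unfolding chain_index_set_def using ps(2) map
      by (intro bexI[of _ "set js"]) (auto simp: distinct_card)
  next
    fix K assume K: "K \<subseteq> {..<n}" "chain_index_set k ?y K"
    then obtain js where "distinct js" "set js = K" "admissible_chain k (map ?y js)"
      unfolding chain_index_set_def by blast
    then show "\<exists>ps. card K = length ps \<and> set ps \<subseteq> ?y ` {..<n} \<and> admissible_chain k ps"
      using K(1) by (intro exI[of _ "map ?y js"]) (auto simp: distinct_card)
  qed
  then show ?thesis
    unfolding L_def max_chain_length_def max_card_below_def by (intro arg_cong[of _ _ Max]) auto
qed

subsection \<open>Measurability of admissibility\<close>

lemma pred_sorted_wrt: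
  assumes "\<And>f g. f \<in> set fs \<Longrightarrow> g \<in> set fs \<Longrightarrow> Measurable.pred M (\<lambda>x. P (f x) (g x))"
  shows "Measurable.pred M (\<lambda>x. sorted_wrt P (map (\<lambda>f. f x) fs))"
  using assms by (induction fs) (auto intro!: pred_intros_logic pred_intros_finite)

lemma borel_measurable_fst_snd [measurable (raw)]:
  fixes f :: "'a \<Rightarrow> real \<times> real"
  assumes "f \<in> borel_measurable M"
  shows "(\<lambda>x. fst (f x)) \<in> borel_measurable M" "(\<lambda>x. snd (f x)) \<in> borel_measurable M"
  by (intro measurable_compose[OF assms] borel_measurable_continuous_onI continuous_intros)+

lemma pred_eq_real_pair:
  fixes f g :: "'a \<Rightarrow> real \<times> real"
  assumes [measurable]: "f \<in> borel_measurable M" "g \<in> borel_measurable M"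
  shows "Measurable.pred M (\<lambda>x. f x = g x)"
  unfolding prod_eq_iff by measurable

text \<open>Monomials are closed under differentiation; hence the branch of \<open>divdiff\<close>
  for a fully repeated point is measurable in that point.\<close>

lemma funpow_deriv_power: "\<exists>c m. (deriv ^^ j) (\<lambda>x::real. x ^ k) = (\<lambda>x. c * x ^ m)"
proof (induction j)
  case 0
  show ?case by (auto intro!: exI[of _ 1] exI[of _ k])
next
  case (Suc j)
  then obtain c m where cm: "(deriv ^^ j) (\<lambda>x::real. x ^ k) = (\<lambda>x. c * x ^ m)" by blast
  have "deriv (\<lambda>x::real. c * x ^ m) x = c * real m * x ^ (m - 1)" for x
    by (rule DERIV_imp_deriv) (auto intro!: derivative_eq_intros)
  then show ?case using cm by auto
qed

lemma borel_measurable_divdiff: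
  fixes fs :: "('a \<Rightarrow> real \<times> real) list"
  assumes "\<And>f. f \<in> set fs \<Longrightarrow> f \<in> borel_measurable M"
  shows "(\<lambda>x. divdiff k (map (\<lambda>f. f x) fs)) \<in> borel_measurable M"
  using assms
proof (induction fs rule: length_induct)
  case (1 fs)
  consider "fs = []" | f where "fs = [f]" | f g gs where "fs = f # g # gs"
    by (metis neq_Nil_conv)
  then show ?case
  proof cases
    case 2
    then have [measurable]: "f \<in> borel_measurable M" using 1 by simp
    show ?thesis unfolding 2 by simp
  next
    case (3 f g gs)
    have [measurable]: "f \<in> borel_measurable M" "last (g # gs) \<in> borel_measurable M"
      using 1(2)[of f] 1(2)[of "last (g # gs)"] 3 last_in_set[of "g # gs"] by (simp_all del: last.simps)
    have [measurable]: "(\<lambda>x. divdiff k (map (\<lambda>f. f x) (g # gs))) \<in> borel_measurable M"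
      by (rule 1(1)[rule_format]) (use 1(2) 3 in auto)
    have [measurable]: "(\<lambda>x. divdiff k (map (\<lambda>f. f x) (butlast fs))) \<in> borel_measurable M"
      by (rule 1(1)[rule_format]) (use 3 in simp, use 1(2) in \<open>blast dest: in_set_butlastD\<close>)
    obtain c m where cm: "(deriv ^^ length (g # gs)) (\<lambda>x::real. x ^ k) = (\<lambda>x. c * x ^ m)"
      using funpow_deriv_power by blast
    have [measurable]: "Measurable.pred M (\<lambda>x. \<forall>h\<in>set (g # gs). h x = f x)"
      by (intro pred_intros_finite pred_eq_real_pair) (use 1(2) 3 in auto)
    \<comment> \<open>The recursion is restated with the list structure fixed and only the points
      depending on \<open>x\<close>, so that each branch and the branching condition are visibly
      measurable.\<close>
    have "divdiff k (map (\<lambda>f. f x) fs) =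
      (if \<forall>h\<in>set (g # gs). h x = f x
       then c * fst (f x) ^ m / fact (length (g # gs))
       else (divdiff k (map (\<lambda>f. f x) (g # gs)) - divdiff k (map (\<lambda>f. f x) (butlast fs))) /
         (fst (last (g # gs) x) - fst (f x)))" for x
    proof -
      have "set (map (\<lambda>f. f x) (g # gs)) = {f x} \<longleftrightarrow> (\<forall>h\<in>set (g # gs). h x = f x)"
        by auto
      moreover have "last (map (\<lambda>f. f x) (g # gs)) = last (g # gs) x"
        by (simp add: last_map del: last.simps list.map)
      moreover have "butlast (map (\<lambda>f. f x) fs) = map (\<lambda>f. f x) (butlast fs)"
        by (simp add: map_butlast)
      ultimately show ?thesis
        using cm unfolding 3 by (simp del: last.simps butlast.simps)
    qed
    then show ?thesis by (simp only:) measurable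
  qed simp
qed

lemma subseq_mapD:
  "subseq qs (map h fs) \<Longrightarrow> \<exists>gs. subseq gs fs \<and> qs = map h gs"
  by (auto simp: subseq_conv_nths nths_map)

lemma pred_k_monotone:
  fixes fs :: "('a \<Rightarrow> real \<times> real) list"
  assumes fs: "\<And>f. f \<in> set fs \<Longrightarrow> f \<in> borel_measurable M"
  shows "Measurable.pred M (\<lambda>x. k_monotone k (map (\<lambda>f. f x) fs))"
proof -
  have count: "(\<lambda>x. count_list (map (\<lambda>f. f x) gs) (g x)) \<in> measurable M (count_space UNIV)"
    if "set gs \<subseteq> set fs" "g \<in> set fs" for gs g
    using that(1)
  proof (induction gs)
    case (Cons h gs)
    have [measurable]: "Measurable.pred M (\<lambda>x. h x = g x)"
      by (rule pred_eq_real_pair) (use Cons that fs in auto)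
    show ?case using Cons by simp
  qed simp
  \<comment> \<open>The quantifier over lists that depend on \<open>x\<close> becomes one over the
    finitely many sublists of \<open>fs\<close>, which do not.\<close>
  have iff: "(\<forall>qs. subseq qs (map (\<lambda>f. f x) fs) \<and> length qs = k + 1 \<longrightarrow> positive_tuple k qs) \<longleftrightarrow>
    (\<forall>gs\<in>set (List.subseqs fs). length gs = k + 1 \<longrightarrow> 0 \<le> divdiff k (map (\<lambda>f. f x) gs))" for x
    unfolding positive_tuple_def
    using subseq_map[of _ fs "\<lambda>f. f x"] subseq_mapD[of _ "\<lambda>f. f x" fs] by fastforce
  have iff': "(\<forall>p\<in>set (map (\<lambda>f. f x) fs). 1 < count_list (map (\<lambda>f. f x) fs) p \<longrightarrow> p = \<gamma> k (fst p)) \<longleftrightarrow>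
    (\<forall>g\<in>set fs. 1 < count_list (map (\<lambda>f. f x) fs) (g x) \<longrightarrow> g x = \<gamma> k (fst (g x)))" for x
    by simp
  have cm: "Measurable.pred M (\<lambda>x. 1 < count_list (map (\<lambda>f. f x) fs) (g x))" if "g \<in> set fs" for g
    using count[OF subset_refl that] by simp
  have gm: "Measurable.pred M (\<lambda>x. g x = \<gamma> k (fst (g x)))" if "g \<in> set fs" for g
    by (rule pred_eq_real_pair) (use fs[OF that] in \<open>simp_all add: \<gamma>_def\<close>)
  have dm: "Measurable.pred M (\<lambda>x. 0 \<le> divdiff k (map (\<lambda>f. f x) gs))" if "gs \<in> set (List.subseqs fs)" for gs
  proof -
    have [measurable]: "(\<lambda>x. divdiff k (map (\<lambda>f. f x) gs)) \<in> borel_measurable M"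
      by (rule borel_measurable_divdiff) (use that fs in \<open>auto dest: set_mp[OF set_subseq]\<close>)
    show ?thesis by measurable
  qed
  have sm: "Measurable.pred M (\<lambda>x. sorted_wrt (\<lambda>p q. fst p < fst q \<or> p = q) (map (\<lambda>f. f x) fs))"
  proof (rule pred_sorted_wrt)
    fix f g assume fg: "f \<in> set fs" "g \<in> set fs"
    note [measurable] = fs[OF fg(1)] fs[OF fg(2)] pred_eq_real_pair[OF fs[OF fg(1)] fs[OF fg(2)]]
    show "Measurable.pred M (\<lambda>x. fst (f x) < fst (g x) \<or> f x = g x)" by measurable
  qed
  have "Measurable.pred M (\<lambda>x. \<forall>g\<in>set fs. 1 < count_list (map (\<lambda>f. f x) fs) (g x) \<longrightarrow> g x = \<gamma> k (fst (g x)))"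
    by (rule pred_intros_finite(3)) (simp, intro pred_intros_logic cm gm)
  moreover have "Measurable.pred M (\<lambda>x. \<forall>gs\<in>set (List.subseqs fs). length gs = k + 1 \<longrightarrow> 0 \<le> divdiff k (map (\<lambda>f. f x) gs))"
    by (rule pred_intros_finite(3)) (simp, intro pred_intros_logic dm, simp_all)
  ultimately show ?thesis
    unfolding k_monotone_def iff iff' by (intro pred_intros_logic sm)
qed

lemma pred_admissible_chain:
  fixes fs :: "('a \<Rightarrow> real \<times> real) list"
  assumes fs: "\<And>f. f \<in> set fs \<Longrightarrow> f \<in> borel_measurable M"
  shows "Measurable.pred M (\<lambda>x. admissible_chain k (map (\<lambda>f. f x) fs))"
proof -
  have 1: "\<gamma> k 0 # map (\<lambda>f. f x) fs @ [\<gamma> k 1] = map (\<lambda>f. f x) ((\<lambda>_. \<gamma> k 0) # fs @ [\<lambda>_. \<gamma> k 1])"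
    and 2: "replicate k (\<gamma> k 0) @ map (\<lambda>f. f x) fs @ replicate k (\<gamma> k 1)
      = map (\<lambda>f. f x) (replicate k (\<lambda>_. \<gamma> k 0) @ fs @ replicate k (\<lambda>_. \<gamma> k 1))" for x
    by simp_all
  show ?thesis
    unfolding admissible_chain_def 1 2
  proof (intro pred_intros_logic pred_sorted_wrt pred_k_monotone)
    fix f g assume "f \<in> set ((\<lambda>_. \<gamma> k 0) # fs @ [\<lambda>_. \<gamma> k 1])" "g \<in> set ((\<lambda>_. \<gamma> k 0) # fs @ [\<lambda>_. \<gamma> k 1])"
    then have [measurable]: "f \<in> borel_measurable M" "g \<in> borel_measurable M" using fs by auto
    show "Measurable.pred M (\<lambda>x. fst (f x) < fst (g x))" by measurable
  qed (use fs in \<open>auto split: if_splits\<close>)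
qed

text \<open>A finite index set has only finitely many orderings, each giving a measurable
  condition.\<close>

lemma pred_chain_index_set:
  assumes "finite K" and Y: "\<And>i. i \<in> K \<Longrightarrow> (\<lambda>x. Y x i) \<in> borel_measurable M"
  shows "Measurable.pred M (\<lambda>x. chain_index_set k (Y x) K)"
proof -
  have "chain_index_set k (Y x) K \<longleftrightarrow>
    (\<exists>js\<in>{js. set js = K \<and> distinct js}. admissible_chain k (map (\<lambda>f. f x) (map (\<lambda>i x. Y x i) js)))" for x
    unfolding chain_index_set_def by (auto simp: comp_def)
  then show ?thesis
  proof (simp only:, intro pred_intros_finite pred_admissible_chain)
    have "{js. set js = K \<and> distinct js} \<subseteq> {js. set js \<subseteq> K \<and> length js = card K}"
      by (auto simp: distinct_card)
    then show "finite {js. set js = K \<and> distinct js}"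
      using finite_lists_length_eq[OF assms(1)] finite_subset by blast
  qed (use Y in auto)
qed

subsection \<open>Concentration of the chain length\<close>

text \<open>By independence the vector of points has a product law, and the chain length is a
  configuration function of that vector. The general bound is proved on the product space and pulled
  back to \<open>M\<close>.\<close>

lemma L_concentration:
  fixes M :: "'a measure" and Y :: "nat \<Rightarrow> 'a \<Rightarrow> real \<times> real"
  assumes M: "prob_space M" and "n \<ge> 1"
    and indep: "prob_space.indep_vars M (\<lambda>_. borel) Y {..<n}"
    and chain: "admissible_chain k []"
  defines "\<mu> \<equiv> (\<integral>\<omega>. real (L k n Y \<omega>) \<partial>M)"
  assumes t: "0 < \<mu>" "0 \<le> t" "t \<le> 2 * \<mu>"
  shows "measure M {\<omega> \<in> space M. \<bar>real (L k n Y \<omega>) - \<mu>\<bar> > t} \<le> 2 * exp (- (t\<^sup>2 / (4 * \<mu>)))"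
proof -
  interpret prob_space M by (rule M)
  have Y: "random_variable borel (Y i)" if "i < n" for i
    using indep that by (auto simp: indep_vars_def)
  \<comment> \<open>A probability measure is required at every index; those from \<open>n\<close> on
    receive the law of \<open>Y 0\<close>, which is a random variable because
    \<open>n \<ge> 1\<close>.\<close>
  define D where "D i = distr M borel (Y (if i < n then i else 0))" for i
  have D: "prob_space (D i)" for i
    unfolding D_def by (rule prob_space_distr) (use Y \<open>n \<ge> 1\<close> in auto)
  have sets_D: "sets (D i) = sets borel" for i by (simp add: D_def)
  let ?I = "{..<n}"
  define V where "V \<omega> = (\<lambda>i\<in>?I. Y i \<omega>)" for \<omega>
  have V: "V \<in> measurable M (PiM ?I D)"
    unfolding V_def by (rule measurable_restrict) (use Y in \<open>simp add: D_def\<close>)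
  have "distr M (PiM ?I (\<lambda>_. borel)) V = PiM ?I (\<lambda>i. distr M borel (Y i))"
    unfolding V_def using indep_vars_iff_distr_eq_PiM'[where I="?I" and M'="\<lambda>_. borel" and X=Y] indep Y \<open>n \<ge> 1\<close>
    by (auto simp: lessThan_empty_iff)
  also have "PiM ?I (\<lambda>i. distr M borel (Y i)) = PiM ?I D"
    by (rule PiM_cong) (auto simp: D_def)
  also have "distr M (PiM ?I (\<lambda>_. borel)) V = distr M (PiM ?I D) V"
    by (rule distr_cong) (auto intro!: sets_PiM_cong simp: sets_D)
  finally have distr: "distr M (PiM ?I D) V = PiM ?I D" .
  define Z where "Z x = max_card_below ?I (chain_index_set k x)" for x
  have meas: "Measurable.pred (PiM ?I D) (\<lambda>x. chain_index_set k x K)" if "K \<subseteq> ?I" for K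
  proof (rule pred_chain_index_set)
    show "finite K" using that by (rule finite_subset) simp
    show "(\<lambda>x. x i) \<in> borel_measurable (PiM ?I D)" if "i \<in> K" for i
      using measurable_component_singleton[of i ?I D] that \<open>K \<subseteq> ?I\<close> by (auto cong: measurable_cong_sets simp: sets_D)
  qed
  have Z_meas: "Z \<in> measurable (PiM ?I D) (count_space UNIV)"
    unfolding Z_def max_card_below_def
    by (intro measurable_Max_nat pred_intros_finite pred_intros_logic meas) auto
  \<comment> \<open>Restricting the vector to the first \<open>n\<close> indices is harmless, as
    \<open>chain_index_set\<close> reads only the coordinates in its index set.\<close>
  have LZ: "L k n Y \<omega> = Z (V \<omega>)" for \<omega>
    unfolding L_eq_max_card_below Z_def
    by (intro max_card_below_cong chain_index_set_cong) (auto simp: V_def)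
  have \<mu>: "\<mu> = (\<integral>x. real (Z x) \<partial>PiM ?I D)"
    unfolding \<mu>_def LZ by (subst distr[symmetric], subst integral_distr[OF V]) (use Z_meas in auto)
  have empty: "chain_index_set k x {}" for x :: "nat \<Rightarrow> real \<times> real"
    unfolding chain_index_set_def using chain by (intro exI[of _ "[]"]) simp
  have "measure (PiM ?I D) {x \<in> space (PiM ?I D). \<bar>real (Z x) - \<mu>\<bar> \<ge> t} \<le> 2 * exp (- (t\<^sup>2 / (4 * \<mu>)))"
    unfolding \<mu> Z_def
  proof (rule configuration_function_concentration[where good = "chain_index_set k", OF D _ meas empty])
    show "chain_index_set k (x(i := y)) K = chain_index_set k x K" if "i \<notin> K" for x K i y
      by (rule chain_index_set_cong) (use that in auto)
  qed (use t chain_index_set_mono in \<open>auto simp: \<mu> Z_def\<close>)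
  moreover have "measure (PiM ?I D) {x \<in> space (PiM ?I D). \<bar>real (Z x) - \<mu>\<bar> > t}
      \<le> measure (PiM ?I D) {x \<in> space (PiM ?I D). \<bar>real (Z x) - \<mu>\<bar> \<ge> t}"
  proof -
    interpret P: prob_space "PiM ?I D" by (rule prob_space_PiM) (rule D)
    note [measurable] = Z_meas
    show ?thesis by (rule P.finite_measure_mono) (auto, measurable)
  qed
  moreover have "measure (PiM ?I D) {x \<in> space (PiM ?I D). \<bar>real (Z x) - \<mu>\<bar> > t}
      = measure M {\<omega> \<in> space M. \<bar>real (L k n Y \<omega>) - \<mu>\<bar> > t}"
  proof -
    note [measurable] = Z_meas
    have "measure (distr M (PiM ?I D) V) {x \<in> space (PiM ?I D). \<bar>real (Z x) - \<mu>\<bar> > t}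
      = measure M (V -` {x \<in> space (PiM ?I D). \<bar>real (Z x) - \<mu>\<bar> > t} \<inter> space M)"
      by (rule measure_distr[OF V]) measurable
    also have "V -` {x \<in> space (PiM ?I D). \<bar>real (Z x) - \<mu>\<bar> > t} \<inter> space M
      = {\<omega> \<in> space M. \<bar>real (L k n Y \<omega>) - \<mu>\<bar> > t}"
      using measurable_space[OF V] by (auto simp: LZ)
    finally show ?thesis by (simp only: distr)
  qed
  ultimately show ?thesis by simp
qed

text \<open>\<open>Max {}\<close> is a junk value; only its constancy matters.\<close>

lemma L_const_if_not_admissible:
  assumes "\<not> admissible_chain k []"
  shows "L k n Y \<omega> = Max {}"
proof -
  have "\<not> admissible_chain k ps" for ps
    using assms admissible_chain_subseq[of "[]" ps k] by auto
  then show ?thesis by (simp add: L_def max_chain_length_def)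
qed

theorem theorem2p4:
  fixes k :: nat
    and M :: "'a measure"
    and X :: "nat \<Rightarrow> nat \<Rightarrow> 'a \<Rightarrow> real \<times> real"
    and \<alpha> \<epsilon> :: real
  assumes "k \<ge> 1"
    and "prob_space M"
    and "\<And>n. n \<ge> 1 \<Longrightarrow> prob_space.indep_vars M (\<lambda>_. borel) (X n) {..<n}"
    and "\<And>n i. n \<ge> 1 \<Longrightarrow> i < n \<Longrightarrow>
           distr M borel (X n i) = uniform_measure lborel ({0..1} \<times> {0..1})"
    and "(\<lambda>n. real n powr (- 1 / (real k + 1)) * (\<integral>\<omega>. real (L k n (X n) \<omega>) \<partial>M)) \<longlonglongrightarrow> \<alpha>"
    and "\<alpha> > 0"
    and "\<epsilon> > 0"
  shows "\<forall>\<^sub>F n in sequentially.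
           measure M {\<omega> \<in> space M.
             \<bar>real (L k n (X n) \<omega>) - (\<integral>\<omega>'. real (L k n (X n) \<omega>') \<partial>M)\<bar>
               > \<epsilon> * real n powr (1 / (2 * (real k + 1)))}
           \<le> 5 * exp (- (\<epsilon>\<^sup>2 / (5 * \<alpha>)))"
proof -
  interpret prob_space M by fact
  define \<mu> where "\<mu> n = (\<integral>\<omega>. real (L k n (X n) \<omega>) \<partial>M)" for n
  define t where "t n = \<epsilon> * real n powr (1 / (2 * (real k + 1)))" for n :: nat
  define r where "r n = real n powr (- 1 / (real k + 1)) * \<mu> n" for n
  show ?thesis
  proof (cases "admissible_chain k []")
    \<comment> \<open>Here \<open>L\<close> is constant, so it equals its mean and the deviation
      event is empty.\<close>
    case False
    moreover have "\<not> t n < 0" for n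
      using \<open>\<epsilon> > 0\<close> by (simp add: t_def not_less)
    ultimately have "measure M {\<omega> \<in> space M. \<bar>real (L k n (X n) \<omega>) - \<mu> n\<bar> > t n} = 0" for n
      by (simp add: L_const_if_not_admissible \<mu>_def prob_space)
    then show ?thesis by (simp add: \<mu>_def t_def)
  next
    case chain: True
    have r: "r \<longlonglongrightarrow> \<alpha>" using assms(5) unfolding r_def \<mu>_def .
    \<comment> \<open>The upper bound gives \<open>4 * r n \<le> 5 * \<alpha>\<close> in the
      exponent. The lower bound gives \<open>8 / 5 * \<alpha> \<le> 2 * r n\<close>, from which
      \<open>t n \<le> 2 * \<mu> n\<close> follows.\<close>
    have "4 / 5 * \<alpha> < \<alpha>" "\<alpha> < 5 / 4 * \<alpha>" using \<open>\<alpha> > 0\<close> by auto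
    with r have "\<forall>\<^sub>F n in sequentially. 4 / 5 * \<alpha> < r n" "\<forall>\<^sub>F n in sequentially. r n < 5 / 4 * \<alpha>"
      using order_tendstoD by blast+
    moreover have "(\<lambda>n. \<epsilon> * real n powr (- (1 / (2 * (real k + 1))))) \<longlonglongrightarrow> \<epsilon> * 0"
      by (intro tendsto_mult tendsto_const tendsto_neg_powr filterlim_real_sequentially) simp
    then have "\<forall>\<^sub>F n in sequentially. \<epsilon> * real n powr (- (1 / (2 * (real k + 1)))) < 8 / 5 * \<alpha>"
      using \<open>\<alpha> > 0\<close> by (intro order_tendstoD(2)) auto
    ultimately have "\<forall>\<^sub>F n in sequentially.
      measure M {\<omega> \<in> space M. \<bar>real (L k n (X n) \<omega>) - \<mu> n\<bar> > t n} \<le> 5 * exp (- (\<epsilon>\<^sup>2 / (5 * \<alpha>)))"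
      using eventually_ge_at_top[of 1]
    proof eventually_elim
      case (elim n)
      \<comment> \<open>\<open>s\<close> is the fluctuation scale:
        \<open>t n = \<epsilon> * s\<close>, and the mean is \<open>r n * s^2\<close>.\<close>
      define s where "s = real n powr (1 / (2 * (real k + 1)))"
      have s: "0 < s" using elim(4) by (simp add: s_def)
      have tn: "t n = \<epsilon> * s" by (simp add: t_def s_def)
      have "s\<^sup>2 = real n powr (2 * (1 / (2 * (real k + 1))))"
        unfolding s_def using elim(4) by (subst powr_power) simp_all
      also have "2 * (1 / (2 * (real k + 1))) = 1 / (real k + 1)"
        by (simp add: field_simps)
      finally have s2: "s\<^sup>2 = real n powr (1 / (real k + 1))" .
      have "real n powr (- 1 / (real k + 1)) = inverse (s\<^sup>2)"
        unfolding s2 by (simp add: powr_minus)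
      then have "r n * s\<^sup>2 = \<mu> n * (inverse (s\<^sup>2) * s\<^sup>2)"
        by (simp only: r_def mult_ac)
      then have \<mu>r: "\<mu> n = r n * s\<^sup>2" using s by simp
      have r0: "0 < r n" using elim(1) \<open>\<alpha> > 0\<close> by linarith
      have "\<epsilon> / s < 8 / 5 * \<alpha>"
        using elim(3) unfolding powr_minus s_def[symmetric] divide_inverse[of \<epsilon> s] .
      then have "\<epsilon> / s \<le> 2 * r n" using elim(1) by linarith
      then have "t n \<le> 2 * \<mu> n"
        using s by (simp add: tn \<mu>r field_simps power2_eq_square)
      moreover have "0 < \<mu> n" "0 \<le> t n" using s r0 \<open>\<epsilon> > 0\<close> by (simp_all add: \<mu>r tn)
      ultimately have bound: "prob {\<omega> \<in> space M. \<bar>real (L k n (X n) \<omega>) - \<mu> n\<bar> > t n}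
          \<le> 2 * exp (- ((t n)\<^sup>2 / (4 * \<mu> n)))"
        unfolding \<mu>_def by (intro L_concentration[OF assms(2) elim(4) assms(3)[OF elim(4)] chain])
      \<comment> \<open>The powers of \<open>n\<close> cancel; replacing \<open>4 * r n\<close> by
        \<open>5 * \<alpha>\<close> and the prefactor \<open>2\<close> by \<open>5\<close> gives the
        stated bound.\<close>
      have "(t n)\<^sup>2 / (4 * \<mu> n) = \<epsilon>\<^sup>2 / (4 * r n)"
        using s by (simp add: tn \<mu>r power_mult_distrib)
      also have "\<dots> \<ge> \<epsilon>\<^sup>2 / (5 * \<alpha>)"
        by (rule divide_left_mono) (use elim(2) r0 \<open>\<alpha> > 0\<close> in auto)
      finally have "2 * exp (- ((t n)\<^sup>2 / (4 * \<mu> n))) \<le> 5 * exp (- (\<epsilon>\<^sup>2 / (5 * \<alpha>)))"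
        by (intro mult_mono) auto
      with bound show ?case by linarith
    qed
    then show ?thesis by (simp add: \<mu>_def t_def)
  qed
qed

end
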